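(* The tiered clinching auction is ex-post incentive compatible; that is, for each bidder, sincere bidding is a weakly dominant strategy assuming all other bidders bid truthfully. Explicitly: for every bidder $i$, if all bidders $j\neq i$ bid sincerely, then bidder $i$'s utility from bidding sincerely is at least its utility from any other bidding strategy available to it in the auction. Here bidder $i$'s utility is $\sum_{j=1}^{x_i}u_i(j)$ minus the sum of the prices it pays, where $x_i$ is the number of items it receives and $u_i$ is its true marginal valuation function.
   Context: **Tiered instance.** There are tiers $1,\dots,L$ of items ($1$ lowest quality, $L$ highest). Tier $k$ contains $q_k$ identical items, and $q=\sum_{k=1}^L q_k$. There are $n$ bidders. Bidder $i$ has a tier $\ell(i)\in\{1,\dots,L\}$, the lowest quality it accepts: items of lower tiers are worth zero to it, it accepts items of any tier $\ge \ell(i)$, and beyond that it is indifferent to quality. Its private true marginal valuations are $u_i(1)\ge u_i(2)\ge\dots\ge u_i(q)\ge 0$, where $u_i(j)$ is the value of its $j$-th acceptable item. The true marginal valuations are integers, and all positive ones, over all bidders, are pairwise distinct. **Bidding.** At each price $p=0,1,2,\dots$ each bidder $i$ announces a demand $D_i(p)$, a nonnegative integer. A bidder may never increase its demand after a price increase (monotone activity rule); otherwise announcements are unrestricted, and in particular a bidder's announcements need not be consistent with its true valuations, may drop by several units at once, and may coincide with drops of other bidders. Bidding sincerely (truthfully) means announcing $D_i(p)=\#\{j:u_i(j)>p\}$ at each price $p$. **Submarkets.** For $t=1,\dots,L$, submarket $\mathcal M_t$ consists of the items of tiers $\le t$ and the bidders of tiers $\le t$. **Tiered clinching auction.** State: a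 price $p$ (initially $0$), remaining supplies $r_k$ (initially $r_k=q_k$), and the number $C_i$ of items obtained so far by bidder $i$ (initially $0$). The residual demand of bidder $i$ is $R_i(p)=\max\{D_i(p)-C_i,0\}$. Initial clearing: if a submarket is undersubscribed at the beginning (announced demand of its bidders smaller than its supply), it is immediately cleared by assigning its items at no cost to the bidders in it who demand them; submarkets are treated in increasing order of $t$, items of a cleared submarket that nobody in it demands are removed, and the auction continues with what remains. So from here on no submarket is undersubscribed at the beginning. Then repeat: (1) Going through $t=1,\dots,L$ in increasing order and, for each $t$, through the bidders $i$ with $\ell(i)\le t$ in increasing order of index, search for a pair $(t,i)$ such that $$\sum_{j\ne i,\ \ell(j)\le t}R_j(p)<\sum_{k=1}^t r_k$$ and an item acceptable to $i$ is still available. (2) If such a pair exists, take the first one: bidder $i$ clinches an item in $\mathcal M_t$. It is given an available item of the lowest tier $s\ge\ell(i)$ with $r_s>0$ and is charged $p$ for it; set $r_s\leftarrow r_s-1$, $C_i\leftarrow C_i+1$, and repeat from (1) at the same price. (3) If no such pair exists: terminate if $r_1=\dots=r_L=0$; otherwise set $p\leftarrow p+1$ and repeat from (1). The number of items received by bidder $i$ is $x_i=$ the final value of $C_i$. *)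

theory Defs
  imports Complex_Main "HOL-Library.While_Combinator"
begin

text \<open>Tiers are numbered \<open>1..L\<close> and bidders \<open>1..n\<close>; \<open>qty\<close> and \<open>low\<close> (the lowest
  quality a bidder accepts) are only meaningful on these ranges.\<close>

record market =
  num_tiers :: nat
  qty :: "nat \<Rightarrow> nat"
  num_bidders :: nat
  low :: "nat \<Rightarrow> nat"

definition tiers :: "market \<Rightarrow> nat set" where
  "tiers M = {1..num_tiers M}"

definition bidders :: "market \<Rightarrow> nat set" where
  "bidders M = {1..num_bidders M}"

definition total_qty :: "market \<Rightarrow> nat" where
  "total_qty M = (\<Sum>k\<in>tiers M. qty M k)"

text \<open>\<open>u i j\<close> is the true value to bidder \<open>i\<close> of its \<open>j\<close>-th acceptable item,
  for \<open>1 \<le> j \<le> total_qty M\<close>.\<close>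

definition tiered_instance :: "market \<Rightarrow> (nat \<Rightarrow> nat \<Rightarrow> nat) \<Rightarrow> bool" where
  "tiered_instance M u \<longleftrightarrow>
     (\<forall>i\<in>bidders M. low M i \<in> tiers M) \<and>
     (\<forall>i\<in>bidders M. antimono_on {1..total_qty M} (u i)) \<and>
     inj_on (\<lambda>(i, j). u i j)
       {(i, j). i \<in> bidders M \<and> j \<in> {1..total_qty M} \<and> u i j > 0}"

text \<open>A demand profile \<open>D\<close> gives the demand \<open>D i p\<close> announced by bidder \<open>i\<close> at price \<open>p\<close>.
  The auction is deterministic, so against opponents whose announcements depend on the price
  only, a strategy reacting to the history amounts to some fixed demand function.\<close>

type_synonym profile = "nat \<Rightarrow> nat \<Rightarrow> nat"

definition sincere :: "market \<Rightarrow> (nat \<Rightarrow> nat \<Rightarrow> nat) \<Rightarrow> profile" where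
  "sincere M u i p = card {j \<in> {1..total_qty M}. u i j > p}"

definition sub_bidders :: "market \<Rightarrow> nat \<Rightarrow> nat set" where
  "sub_bidders M t = {i \<in> bidders M. low M i \<le> t}"

record auction_state =
  price :: nat
  remaining :: "nat \<Rightarrow> nat"
  obtained :: "nat \<Rightarrow> nat"
  paid :: "nat \<Rightarrow> nat"

text \<open>Truncated subtraction: this is \<open>max (D i p - C i) 0\<close>.\<close>

definition residual :: "profile \<Rightarrow> auction_state \<Rightarrow> nat \<Rightarrow> nat" where
  "residual D s i = D i (price s) - obtained s i"

definition sub_supply :: "auction_state \<Rightarrow> nat \<Rightarrow> nat" where
  "sub_supply s t = (\<Sum>k=1..t. remaining s k)"

text \<open>Clearing an undersubscribed submarket \<open>t\<close> serves the whole (residual) demand of its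
  bidders for free and leaves no items of tiers \<open>\<le> t\<close>, the undemanded ones being removed.
  Such an assignment exists when the smaller submarkets have been treated before: each of them
  then has at least as much residual demand as supply, so for every \<open>t' < t\<close> the bidders
  of tiers \<open>t' + 1..t\<close> demand fewer items than these tiers contain. Which acceptable items
  a bidder gets has no effect on the rest of the auction.\<close>

definition clear :: "market \<Rightarrow> profile \<Rightarrow> nat \<Rightarrow> auction_state \<Rightarrow> auction_state" where
  "clear M D t s =
     (if (\<Sum>j\<in>sub_bidders M t. residual D s j) < sub_supply s t
      then s\<lparr>remaining := (\<lambda>k. if k \<le> t then 0 else remaining s k),
             obtained := (\<lambda>j. if j \<in> sub_bidders M t then obtained s j + residual D s j
                               else obtained s j)\<rparr>
      else s)"

definition initial_state :: "market \<Rightarrow> auction_state" where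
  "initial_state M = \<lparr>price = 0, remaining = qty M, obtained = (\<lambda>_. 0), paid = (\<lambda>_. 0)\<rparr>"

definition initial_clearing :: "market \<Rightarrow> profile \<Rightarrow> auction_state" where
  "initial_clearing M D = fold (clear M D) [1..<Suc (num_tiers M)] (initial_state M)"

definition available :: "market \<Rightarrow> auction_state \<Rightarrow> nat \<Rightarrow> nat \<Rightarrow> bool" where
  "available M s i k \<longleftrightarrow> k \<in> tiers M \<and> low M i \<le> k \<and> remaining s k > 0"

definition can_clinch :: "market \<Rightarrow> profile \<Rightarrow> auction_state \<Rightarrow> nat \<times> nat \<Rightarrow> bool" where
  "can_clinch M D s = (\<lambda>(t, i).
     (\<Sum>j\<in>sub_bidders M t - {i}. residual D s j) < sub_supply s t \<and>
     (\<exists>k. available M s i k))"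

definition search_order :: "market \<Rightarrow> (nat \<times> nat) list" where
  "search_order M =
     [(t, i). t \<leftarrow> [1..<Suc (num_tiers M)], i \<leftarrow> [1..<Suc (num_bidders M)], low M i \<le> t]"

definition first_pair :: "market \<Rightarrow> profile \<Rightarrow> auction_state \<Rightarrow> (nat \<times> nat) option" where
  "first_pair M D s = find (can_clinch M D s) (search_order M)"

definition clinch :: "market \<Rightarrow> nat \<Rightarrow> auction_state \<Rightarrow> auction_state" where
  "clinch M i s =
     (let k = (LEAST k. available M s i k)
      in s\<lparr>remaining := (remaining s)(k := remaining s k - 1),
           obtained := (obtained s)(i := obtained s i + 1),
           paid := (paid s)(i := paid s i + price s)\<rparr>)"

definition step :: "market \<Rightarrow> profile \<Rightarrow> auction_state \<Rightarrow> auction_state" where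
  "step M D s =
     (case first_pair M D s of
        Some (t, i) \<Rightarrow> clinch M i s
      | None \<Rightarrow> s\<lparr>price := price s + 1\<rparr>)"

definition finished :: "market \<Rightarrow> profile \<Rightarrow> auction_state \<Rightarrow> bool" where
  "finished M D s \<longleftrightarrow> first_pair M D s = None \<and> (\<forall>k\<in>tiers M. remaining s k = 0)"

text \<open>The loop terminates whenever all bidders but at most one eventually announce demand 0,
  in particular if all bidders but one bid sincerely: once they do, take the lowest tier \<open>t\<close>
  with an item left. If the exceptional bidder is in submarket \<open>t\<close>, it can clinch; otherwise
  any bidder in submarket \<open>t\<close> can, and there is one, because the initial clearing removes the
  items of a submarket without bidders.\<close>

definition auction :: "market \<Rightarrow> profile \<Rightarrow> auction_state" where
  "auction M D = while (\<lambda>s. \<not> finished M D s) (step M D) (initial_clearing M D)"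

definition utility :: "market \<Rightarrow> (nat \<Rightarrow> nat \<Rightarrow> nat) \<Rightarrow> profile \<Rightarrow> nat \<Rightarrow> int" where
  "utility M u D i =
     (\<Sum>j=1..obtained (auction M D) i. int (u i j)) - int (paid (auction M D) i)"

end

theory Submission
  imports Defs
begin

text \<open>Fix bidder \<open>i\<close>. In a state \<open>s\<close> let \<open>g t\<close> be the remaining supply of submarket \<open>t\<close> minus the
  residual demand at price \<open>p\<close> of its bidders other than \<open>i\<close>, and let \<open>reach s p\<close> be what \<open>i\<close>
  has already obtained plus \<open>max g\<close> over all \<open>t\<close> minus \<open>max g\<close> over the \<open>t\<close> below the tier of \<open>i\<close>.
  The initial value \<open>threshold p\<close> depends on the opponents only. Submarkets without \<open>i\<close> are never
  undersubscribed, since sincere opponents drop at most one unit per price; hence no clearing or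
  clinching step increases \<open>reach s p\<close> for \<open>p\<close> at or above the current price. So \<open>i\<close> pays for its
  \<open>k\<close>-th item at least \<open>cost k\<close>, the least price with \<open>k \<le> threshold p\<close>, whatever it bids.
  If \<open>i\<close> is sincere too, then \<open>min (threshold p) (D i p) \<le> reach s p\<close> is also invariant, so that
  \<open>i\<close> pays exactly \<open>cost k\<close> and wins only items with \<open>cost k \<le> u i k\<close> and all those
  with \<open>cost k < u i k\<close>.\<close>

section \<open>Sincere demand functions\<close>

lemma sincere_antimono: "antimono (sincere M u j)"
  unfolding sincere_def by (intro antimonoI card_mono) auto

text \<open>As \<open>u j\<close> is nonincreasing, the units worth more than \<open>p\<close> form
  an initial segment of the range.\<close>

lemma sincere_ge_iff:
  assumes "tiered_instance M u" "j \<in> bidders M" "k \<in> {1..total_qty M}"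
  shows "k \<le> sincere M u j p \<longleftrightarrow> p < u j k"
proof
  have anti: "antimono_on {1..total_qty M} (u j)"
    using assms unfolding tiered_instance_def by blast
  show "k \<le> sincere M u j p" if "p < u j k"
  proof -
    have "{1..k} \<subseteq> {l \<in> {1..total_qty M}. p < u j l}"
      using that assms(3) monotone_onD[OF anti] by (fastforce intro: less_le_trans)
    from card_mono[OF _ this] show ?thesis
      unfolding sincere_def by simp
  qed
  show "p < u j k" if le: "k \<le> sincere M u j p"
  proof (rule ccontr)
    assume "\<not> p < u j k"
    then have "{l \<in> {1..total_qty M}. p < u j l} \<subseteq> {1..<k}"
      using assms(3) monotone_onD[OF anti, of k] by (force simp: not_less)
    from card_mono[OF _ this] show False
      using le assms(3) unfolding sincere_def by (simp, linarith)
  qed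
qed

lemma sincere_Suc:
  "sincere M u j p = sincere M u j (Suc p) + card {l \<in> {1..total_qty M}. u j l = Suc p}"
proof -
  have "{l \<in> {1..total_qty M}. p < u j l} =
      {l \<in> {1..total_qty M}. Suc p < u j l} \<union> {l \<in> {1..total_qty M}. u j l = Suc p}"
    by auto
  then show ?thesis
    unfolding sincere_def by (simp add: card_Un_disjoint disjoint_iff)
qed

text \<open>Positive values are distinct, so at most one pair of bidder and unit is worth exactly
  \<open>Suc p\<close>. Together with \<open>sincere_Suc\<close>, a price increase lowers the joint
  sincere demand of \<open>S\<close> by at most one.\<close>

lemma sincere_drop_le_1:
  assumes "tiered_instance M u" "S \<subseteq> bidders M"
  shows "(\<Sum>j\<in>S. card {l \<in> {1..total_qty M}. u j l = Suc p}) \<le> 1"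
proof -
  let ?A = "\<lambda>j. {l \<in> {1..total_qty M}. u j l = Suc p}"
  have fin: "finite S"
    using assms(2) finite_subset unfolding bidders_def by blast
  have inj: "inj_on (\<lambda>(i, j). u i j)
       {(i, j). i \<in> bidders M \<and> j \<in> {1..total_qty M} \<and> u i j > 0}"
    using assms(1) unfolding tiered_instance_def by blast
  have "x = y" if "x \<in> Sigma S ?A" "y \<in> Sigma S ?A" for x y
    using that assms(2) by (intro inj_onD[OF inj]) (auto split: prod.splits)
  then have "card (Sigma S ?A) \<le> Suc 0"
    using fin by (subst card_le_Suc0_iff_eq) auto
  then show ?thesis
    using fin by (simp add: card_SigmaI)
qed

subsection \<open>Maxima of a function over initial segments\<close>

text \<open>Index 0 is included on purpose: it stands for the empty submarket, whose gap is 0, so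
  the peaks taken later are nonnegative.\<close>

definition peak :: "(nat \<Rightarrow> int) \<Rightarrow> nat \<Rightarrow> int" where
  "peak g T = Max (g ` {..T})"

lemma peak_ge: "t \<le> T \<Longrightarrow> g t \<le> peak g T"
  unfolding peak_def by simp

lemma peak_attained: obtains t where "t \<le> T" "peak g T = g t"
proof -
  have "peak g T \<in> g ` {..T}"
    unfolding peak_def by (rule Max_in) auto
  then show ?thesis using that by auto
qed

lemma peak_le_iff: "peak g T \<le> x \<longleftrightarrow> (\<forall>t\<le>T. g t \<le> x)"
  unfolding peak_def by auto

lemma peak_mono: "m \<le> T \<Longrightarrow> peak g m \<le> peak g T"
  by (auto simp: peak_le_iff intro: peak_ge)

lemma peak_cong: "(\<And>t. t \<le> T \<Longrightarrow> g t = h t) \<Longrightarrow> peak g T = peak h T"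
  unfolding peak_def by (rule arg_cong[where f = Max]) auto

text \<open>The raised values still do not exceed \<open>g (a - 1)\<close>, which lies just before
  the raised stretch. This models a clinch by an opponent that wants the item: between its tier and
  that of the item, demand falls but supply does not.\<close>

lemma peak_bump:
  assumes "\<And>t. g' t = g t + (if a \<le> t \<and> t < k then 1 else 0)"
    and "\<And>t. a \<le> t \<Longrightarrow> t < k \<Longrightarrow> g t + 1 \<le> g (a - 1)" and "0 < a"
  shows "peak g' T = peak g T"
proof (rule antisym)
  show "peak g' T \<le> peak g T"
    unfolding peak_le_iff
  proof safe
    fix t assume "t \<le> T"
    show "g' t \<le> peak g T"
    proof (cases "a \<le> t \<and> t < k")
      case True
      then have "g (a - 1) \<le> peak g T"
        using \<open>t \<le> T\<close> by (intro peak_ge) linarith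
      then show ?thesis
        using True assms(1,2)[of t] by simp
    qed (use assms(1)[of t] peak_ge[of t T g] \<open>t \<le> T\<close> in auto)
  qed
  show "peak g T \<le> peak g' T"
    unfolding peak_le_iff
  proof safe
    fix t assume "t \<le> T"
    then show "g t \<le> peak g' T"
      using assms(1)[of t] peak_ge[of t T g'] by (auto split: if_splits)
  qed
qed

context
  fixes g g' :: "nat \<Rightarrow> int" and k :: nat
  assumes drop: "\<And>t. g' t = g t - (if k \<le> t then 1 else 0)"
begin

lemma peak_drop_ge: "peak g T - 1 \<le> peak g' T"
proof -
  obtain t where "t \<le> T" "peak g T = g t" by (rule peak_attained)
  then show ?thesis
    using drop[of t] peak_ge[of t T g'] by (auto split: if_splits)
qed

lemma peak_drop_le: "peak g' T \<le> peak g T"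
  unfolding peak_le_iff
proof safe
  fix t assume "t \<le> T"
  then show "g' t \<le> peak g T"
    using drop[of t] peak_ge[of t T g] by (auto split: if_splits)
qed

text \<open>Removing an item of tier \<open>k\<close> lowers \<open>g\<close> from \<open>k\<close>
  on. Entries before \<open>k\<close> stay, but are at least one below \<open>g t0\<close>, so they
  cannot keep the maximum up.\<close>

lemma peak_drop_strict:
  assumes "t0 \<le> T" "\<And>t. t < k \<Longrightarrow> g t < g t0"
  shows "peak g' T = peak g T - 1"
proof -
  obtain t where t: "t \<le> T" "peak g' T = g' t" by (rule peak_attained)
  then have "peak g' T \<le> peak g T - 1"
    using drop[of t] peak_ge[of t T g] peak_ge[of t0 T g] assms
    by (cases "t < k") force+
  then show ?thesis
    using peak_drop_ge[of T] by simp
qed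

text \<open>If the peak over \<open>m\<close> falls, its maximiser is at or above \<open>k\<close>,
  and so is everything beyond \<open>m\<close>. Hence the peak over \<open>T\<close> falls too,
  unless it is now attained within \<open>m\<close>, where the new difference is 0.\<close>

lemma peak_drop_diff:
  assumes "m \<le> T"
  shows "peak g' T - peak g' m \<le> peak g T - peak g m"
proof -
  obtain t where t: "t \<le> T" "peak g' T = g' t" by (rule peak_attained)
  obtain t1 where t1: "t1 \<le> m" "peak g m = g t1" by (rule peak_attained)
  consider "k \<le> t" | "t < k" "t \<le> m" | "t1 < k" | "t < k" "m < t" "k \<le> t1" by linarith
  then show ?thesis
  proof cases
    case 1
    then show ?thesis
      using drop[of t] t peak_ge[of t T g] peak_drop_ge[of m] by auto
  next
    case 2
    then show ?thesis
      using drop[of t] t peak_ge[of t m g'] peak_mono[OF assms, of g] by auto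
  next
    case 3
    then show ?thesis
      using drop[of t1] t1 peak_ge[of t1 m g'] peak_drop_le[of T] by auto
  qed (use t1 in linarith)
qed

end

lemma peak_clear_le:
  assumes "\<And>t'. g' t' = (if t' \<le> t then 0 else g t' - g t)" "t \<le> T"
  shows "peak g' T \<le> peak g T - g t"
  unfolding peak_le_iff
proof safe
  fix t' assume "t' \<le> T"
  then show "g' t' \<le> peak g T - g t"
    using assms(1)[of t'] peak_ge[of t' T g] peak_ge[OF assms(2), of g] by (cases "t' \<le> t") auto
qed

text \<open>Beyond \<open>t\<close> this is a shift by \<open>g t\<close>. Before \<open>t\<close>
  the shifted values would be at most 0, the value at \<open>t\<close> itself, so replacing them by
  0 does not affect the maximum.\<close>

lemma peak_clear:
  fixes g g' :: "nat \<Rightarrow> int"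
  assumes "\<And>t'. g' t' = (if t' \<le> t then 0 else g t' - g t)" "t \<le> T"
    and "\<And>t1. t1 < t \<Longrightarrow> g t1 \<le> g t"
  shows "peak g' T = peak g T - g t"
proof (rule antisym[OF peak_clear_le[OF assms(1,2)]])
  obtain t' where t': "t' \<le> T" "peak g T = g t'" by (rule peak_attained)
  then have "g t' - g t \<le> g' t'"
    using assms(1)[of t'] assms(3)[of t'] by (cases "t' < t"; cases "t' = t") auto
  then show "peak g T - g t \<le> peak g' T"
    using t' peak_ge[of t' T g'] by simp
qed

subsection \<open>Excess supply of submarkets\<close>

text \<open>The demand is a parameter so that one bidder can be left out or another price
  considered. Values are integers because oversubscribed submarkets have negative gaps.\<close>

definition gap :: "market \<Rightarrow> auction_state \<Rightarrow> (nat \<Rightarrow> nat) \<Rightarrow> nat \<Rightarrow> int" where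
  "gap M s f t = int (sub_supply s t) - (\<Sum>j\<in>sub_bidders M t. int (f j))"

lemma finite_sub_bidders [simp]: "finite (sub_bidders M t)"
  unfolding sub_bidders_def bidders_def by simp

lemma sub_bidders_mono: "t \<le> t' \<Longrightarrow> sub_bidders M t \<subseteq> sub_bidders M t'"
  unfolding sub_bidders_def by auto

lemma sub_supply_mono: "t \<le> t' \<Longrightarrow> sub_supply s t \<le> sub_supply s t'"
  unfolding sub_supply_def by (rule sum_mono2) auto

lemma sum_sub_bidders_remove:
  "(\<Sum>j\<in>sub_bidders M t - {i}. f j) = (\<Sum>j\<in>sub_bidders M t. (f(i := 0)) j)"
  for f :: "nat \<Rightarrow> nat"
  by (rule sum.mono_neutral_cong_left) auto

lemma gap_upd:
  "gap M s (f(j := x)) t = gap M s f t + (if j \<in> sub_bidders M t then int (f j) - int x else 0)"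
  unfolding gap_def by (auto simp: sum.remove intro!: sum.cong)

lemma gap_diff_mono:
  assumes "t1 \<le> t0" "\<And>x. x \<in> sub_bidders M t0 - sub_bidders M t1 \<Longrightarrow> f x \<le> h x"
  shows "gap M s h t0 - gap M s h t1 \<le> gap M s f t0 - gap M s f t1"
proof -
  have "(\<Sum>x\<in>sub_bidders M t0 - sub_bidders M t1. int (f x))
      \<le> (\<Sum>x\<in>sub_bidders M t0 - sub_bidders M t1. int (h x))"
    using assms(2) by (intro sum_mono) simp
  then show ?thesis
    unfolding gap_def by (simp add: sum_diff[OF _ sub_bidders_mono[OF assms(1)]])
qed

lemma can_clinch_iff:
  "can_clinch M D s (t, j) \<longleftrightarrow> 0 < gap M s ((residual D s)(j := 0)) t \<and> (\<exists>k. available M s j k)"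
  unfolding can_clinch_def gap_def sum_sub_bidders_remove of_nat_sum[symmetric]
  by (simp del: of_nat_sum)

lemma set_search_order:
  "set (search_order M) = {(t, j). t \<in> tiers M \<and> j \<in> sub_bidders M t}"
  unfolding search_order_def tiers_def sub_bidders_def bidders_def by auto

lemma first_pair_SomeD:
  assumes "first_pair M D s = Some (t, j)"
  shows "can_clinch M D s (t, j)" "t \<in> tiers M" "j \<in> sub_bidders M t"
proof -
  have "(t, j) \<in> set (search_order M) \<and> can_clinch M D s (t, j)"
    using assms unfolding first_pair_def find_Some_iff by (metis nth_mem)
  then show "can_clinch M D s (t, j)" "t \<in> tiers M" "j \<in> sub_bidders M t"
    unfolding set_search_order by auto
qed

lemma first_pair_NoneD:
  "first_pair M D s = None \<Longrightarrow> t \<in> tiers M \<Longrightarrow> j \<in> sub_bidders M t \<Longrightarrow> \<not> can_clinch M D s (t, j)"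
  unfolding first_pair_def find_None_iff set_search_order by blast

lemma find_append_Some:
  "\<exists>x\<in>set xs. P x \<Longrightarrow> find P (xs @ ys) = Some y \<Longrightarrow> y \<in> set xs"
  by (induction xs) (auto split: if_splits)

text \<open>The search list is grouped by submarket, so an eligible pair in a smaller submarket
  would have been found first.\<close>

lemma first_pair_earlier:
  assumes fp: "first_pair M D s = Some (t, j)" and t': "t' < t" "t' \<in> tiers M"
    and j': "j' \<in> sub_bidders M t'"
  shows "\<not> can_clinch M D s (t', j')"
proof
  assume cc: "can_clinch M D s (t', j')"
  define block where "block = (\<lambda>ts. concat (map (\<lambda>t. concat (map (\<lambda>i.
    if low M i \<le> t then [(t, i)] else []) [1..<Suc (num_bidders M)])) ts))"
  have "[1..<Suc (num_tiers M)] = [1..<t] @ [t..<Suc (num_tiers M)]"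
    using first_pair_SomeD(2)[OF fp] upt_add_eq_append[of 1 t "Suc (num_tiers M) - t"]
    unfolding tiers_def by simp
  then have "search_order M = block [1..<t] @ block [t..<Suc (num_tiers M)]"
    unfolding search_order_def block_def by simp
  moreover have "(t', j') \<in> set (block [1..<t])"
    using t' j' unfolding block_def tiers_def sub_bidders_def bidders_def
    by (auto simp del: upt_Suc intro!: bexI[of _ t'])
  ultimately have "(t, j) \<in> set (block [1..<t])"
    using fp cc unfolding first_pair_def by (metis find_append_Some)
  then show False
    unfolding block_def by (auto split: if_splits)
qed

section \<open>Supply and gaps after a clinch\<close>

definition least_item :: "market \<Rightarrow> auction_state \<Rightarrow> nat \<Rightarrow> nat" where
  "least_item M s j = (LEAST k. available M s j k)"

lemma available_least_item: "available M s j k \<Longrightarrow> available M s j (least_item M s j)"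
  unfolding least_item_def by (rule LeastI)

lemma not_available_below: "t < least_item M s j \<Longrightarrow> \<not> available M s j t"
  unfolding least_item_def by (rule not_less_Least)

lemma clinch_simps [simp]:
  "price (clinch M j s) = price s"
  "obtained (clinch M j s) = (obtained s)(j := Suc (obtained s j))"
  "paid (clinch M j s) = (paid s)(j := paid s j + price s)"
  unfolding clinch_def by (simp_all add: Let_def)

lemma sub_supply_clinch:
  assumes "available M s j k"
  shows "int (sub_supply (clinch M j s) t) =
    int (sub_supply s t) - (if least_item M s j \<le> t then 1 else 0)"
proof -
  let ?k = "least_item M s j"
  have k: "0 < ?k" "0 < remaining s ?k"
    using available_least_item[OF assms] unfolding available_def tiers_def by auto
  have r: "remaining (clinch M j s) = (remaining s)(?k := remaining s ?k - 1)"
    unfolding clinch_def least_item_def by (simp add: Let_def)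
  show ?thesis
  proof (cases "?k \<le> t")
    case True
    then have mem: "?k \<in> {1..t}" using k by simp
    have "(\<Sum>x\<in>{1..t} - {?k}. remaining (clinch M j s) x) = (\<Sum>x\<in>{1..t} - {?k}. remaining s x)"
      unfolding r by (intro sum.cong) auto
    then have "sub_supply s t = Suc (sub_supply (clinch M j s) t)"
      using k unfolding sub_supply_def by (simp only: sum.remove[OF _ mem] finite_atLeastAtMost) (simp add: r)
    then show ?thesis using True by simp
  next
    case False
    then have "sub_supply (clinch M j s) t = sub_supply s t"
      unfolding sub_supply_def r by (intro sum.cong) auto
    then show ?thesis using False by simp
  qed
qed

lemma gap_clinch:
  "available M s j k \<Longrightarrow>
    gap M (clinch M j s) f t = gap M s f t - (if least_item M s j \<le> t then 1 else 0)"
  unfolding gap_def by (simp add: sub_supply_clinch)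

lemma sub_supply_unavailable:
  assumes "low M j \<in> tiers M" "low M j - 1 \<le> t" "t \<le> num_tiers M"
    and "\<And>k. k \<le> t \<Longrightarrow> \<not> available M s j k"
  shows "sub_supply s t = sub_supply s (low M j - 1)"
  unfolding sub_supply_def
proof (rule sum.mono_neutral_right)
  show "\<forall>k\<in>{1..t} - {1..low M j - 1}. remaining s k = 0"
    using assms unfolding available_def tiers_def by force
qed (use assms in auto)

text \<open>The tiers from \<open>low M j\<close> to \<open>t\<close> are empty, so passing from
  submarket \<open>low M j - 1\<close> to \<open>t\<close> adds no supply but at least the demand of
  \<open>j\<close>.\<close>

lemma gap_unavailable:
  assumes "j \<in> sub_bidders M t" "low M j \<in> tiers M" "t \<le> num_tiers M"
    and "\<And>k. k \<le> t \<Longrightarrow> \<not> available M s j k"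
  shows "gap M s f t + int (f j) \<le> gap M s f (low M j - 1)"
proof -
  have low: "0 < low M j" "low M j \<le> t"
    using assms(1,2) unfolding sub_bidders_def tiers_def by auto
  then have sub: "sub_bidders M (low M j - 1) \<subseteq> sub_bidders M t - {j}"
    unfolding sub_bidders_def by auto
  have "(\<Sum>x\<in>sub_bidders M (low M j - 1). int (f x)) \<le> (\<Sum>x\<in>sub_bidders M t - {j}. int (f x))"
    by (rule sum_mono2[OF _ sub]) auto
  also have "\<dots> = (\<Sum>x\<in>sub_bidders M t. int (f x)) - int (f j)"
    using assms(1) by (simp add: sum_diff1)
  finally show ?thesis
    using sub_supply_unavailable[of M j t s] assms low unfolding gap_def by simp
qed

subsection \<open>Submarkets stay fully subscribed\<close>

text \<open>Two bounds matter for a fixed bidder \<open>i\<close>: \<open>low M i\<close> covers the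
  submarkets without \<open>i\<close>, \<open>Suc (num_tiers M)\<close> covers all; the latter is
  maintained below when \<open>i\<close> is sincere too.\<close>

definition balanced :: "market \<Rightarrow> profile \<Rightarrow> auction_state \<Rightarrow> nat \<Rightarrow> bool" where
  "balanced M D s T \<longleftrightarrow> (\<forall>t<T. gap M s (residual D s) t \<le> 0)"

lemma balancedD: "balanced M D s T \<Longrightarrow> t < T \<Longrightarrow> gap M s (residual D s) t \<le> 0"
  unfolding balanced_def by blast

lemma balanced_mono: "balanced M D s T \<Longrightarrow> T' \<le> T \<Longrightarrow> balanced M D s T'"
  unfolding balanced_def by auto

lemma residual_clinch:
  "residual D (clinch M j s) = (residual D s)(j := residual D s j - 1)"
  unfolding residual_def by auto

lemma balanced_clinch:
  assumes bal: "balanced M D s T" and T: "T \<le> Suc (num_tiers M)"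
    and fp: "first_pair M D s = Some (t0, j)" and low: "low M j \<in> tiers M"
  shows "balanced M D (clinch M j s) T"
  unfolding balanced_def
proof (intro allI impI)
  fix t assume t: "t < T"
  let ?k = "least_item M s j" and ?R = "residual D s"
  obtain k where k: "available M s j k"
    using first_pair_SomeD(1)[OF fp] can_clinch_iff by blast
  have eq: "gap M (clinch M j s) (residual D (clinch M j s)) t =
      gap M s ?R t + (if j \<in> sub_bidders M t then int (?R j) - int (?R j - 1) else 0)
      - (if ?k \<le> t then 1 else 0)"
    by (simp add: residual_clinch gap_upd gap_clinch[OF k])
  show "gap M (clinch M j s) (residual D (clinch M j s)) t \<le> 0"
  proof (cases "j \<in> sub_bidders M t \<and> t < ?k")
    \<comment> \<open>Only here can the gap grow: \<open>j\<close> is in the submarket, but its item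
      lies above it. The growth is at most \<open>?R j\<close>, which \<open>gap_unavailable\<close>
      leaves room for.\<close>
    case True
    then have "gap M s ?R t + int (?R j) \<le> gap M s ?R (low M j - 1)"
      using t T low by (intro gap_unavailable) (auto dest: not_available_below[OF le_less_trans])
    moreover have "low M j - 1 < T"
      using True t unfolding sub_bidders_def by auto
    ultimately show ?thesis
      using eq True balancedD[OF bal, of "low M j - 1"] by auto
  qed (use eq balancedD[OF bal t] in \<open>auto split: if_splits\<close>)
qed

text \<open>A gap grows by at most one, and it was negative if supply is left: at gap 0 some bidder
  has residual demand and could clinch unless its tiers are empty, which
  \<open>gap_unavailable\<close> excludes. Without supply no gap is positive.\<close>

lemma balanced_price:
  assumes inst: "tiered_instance M u"
    and bal: "balanced M D s T" and T: "T \<le> Suc (num_tiers M)"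
    and sincere: "\<And>j. j \<in> bidders M \<Longrightarrow> low M j < T \<Longrightarrow> D j = sincere M u j"
    and fp: "first_pair M D s = None"
  shows "balanced M D (s\<lparr>price := price s + 1\<rparr>) T"
  unfolding balanced_def
proof (intro allI impI)
  fix t assume t: "t < T"
  let ?R = "residual D s" and ?s' = "s\<lparr>price := price s + 1\<rparr>"
  let ?R' = "residual D ?s'"
  let ?e = "\<lambda>j. card {l \<in> {1..total_qty M}. u j l = Suc (price s)}"
  have same_supply: "sub_supply ?s' t = sub_supply s t"
    unfolding sub_supply_def by simp
  have "gap M s ?R t < 0" if pos: "0 < sub_supply s t"
  proof (rule ccontr)
    assume "\<not> gap M s ?R t < 0"
    then have zero: "gap M s ?R t = 0"
      using balancedD[OF bal t] by simp
    with pos have "(\<Sum>j\<in>sub_bidders M t. int (?R j)) \<noteq> 0"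
      unfolding gap_def by simp
    then obtain j where j: "j \<in> sub_bidders M t" "0 < ?R j"
      by (metis (no_types, lifting) gr0I of_nat_0 sum.neutral)
    have low: "low M j \<in> tiers M" "low M j \<le> t"
      using j inst unfolding tiered_instance_def sub_bidders_def by auto
    then have tt: "t \<in> tiers M"
      using t T unfolding tiers_def by auto
    have "\<not> available M s j k" for k
      using first_pair_NoneD[OF fp tt j(1)] j zero
      unfolding can_clinch_iff gap_upd by auto
    then have "gap M s ?R t + int (?R j) \<le> gap M s ?R (low M j - 1)"
      using t T low j by (intro gap_unavailable) auto
    moreover have "low M j - 1 < T"
      using low t by linarith
    ultimately show False
      using balancedD[OF bal, of "low M j - 1"] zero j by simp
  qed
  moreover have "gap M ?s' ?R' t \<le> gap M s ?R t + 1"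
  proof -
    have "?R j \<le> ?R' j + ?e j" if "j \<in> sub_bidders M t" for j
      using that sincere[of j] sincere_Suc[of M u j "price s"] t
      unfolding residual_def sub_bidders_def by auto
    then have "(\<Sum>j\<in>sub_bidders M t. ?R j) \<le> (\<Sum>j\<in>sub_bidders M t. ?R' j + ?e j)"
      by (rule sum_mono)
    also have "\<dots> \<le> (\<Sum>j\<in>sub_bidders M t. ?R' j) + 1"
      using sincere_drop_le_1[OF inst, of "sub_bidders M t" "price s"]
      unfolding sub_bidders_def by (simp add: sum.distrib)
    finally show ?thesis
      unfolding gap_def of_nat_sum[symmetric] same_supply by linarith
  qed
  ultimately show "gap M ?s' ?R' t \<le> 0"
    using same_supply by (cases "sub_supply s t = 0") (auto simp: gap_def sum_nonneg)
qed

section \<open>Supply and gaps after clearing a submarket\<close>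

lemma clear_simps [simp]:
  "price (clear M D t s) = price s" "paid (clear M D t s) = paid s"
  unfolding clear_def by auto

lemma clear_balanced: "gap M s (residual D s) t \<le> 0 \<Longrightarrow> clear M D t s = s"
  unfolding clear_def gap_def of_nat_sum[symmetric] by (simp del: of_nat_sum)

lemma clear_undersubscribed:
  assumes "0 < gap M s (residual D s) t"
  shows "remaining (clear M D t s) = (\<lambda>k. if k \<le> t then 0 else remaining s k)"
    "obtained (clear M D t s) = (\<lambda>j. if j \<in> sub_bidders M t then obtained s j + residual D s j
       else obtained s j)"
  using assms unfolding clear_def gap_def of_nat_sum[symmetric] by (simp_all del: of_nat_sum)

lemma sub_supply_clear:
  assumes "0 < gap M s (residual D s) t"
  shows "int (sub_supply (clear M D t s) t') =
    (if t' \<le> t then 0 else int (sub_supply s t') - int (sub_supply s t))"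
proof (cases "t' \<le> t")
  case False
  then have "{1..t'} = {1..t} \<union> {Suc t..t'}" by auto
  then have "sub_supply s t' = sub_supply s t + (\<Sum>k=Suc t..t'. remaining s k)" for s
    unfolding sub_supply_def by (simp add: sum.union_disjoint)
  moreover have "(\<Sum>k=Suc t..t'. remaining (clear M D t s) k) = (\<Sum>k=Suc t..t'. remaining s k)"
    by (intro sum.cong) (auto simp: clear_undersubscribed[OF assms])
  moreover have "sub_supply (clear M D t s) t = 0"
    unfolding sub_supply_def by (simp add: clear_undersubscribed[OF assms])
  ultimately show ?thesis
    using False by simp
qed (simp add: sub_supply_def clear_undersubscribed[OF assms])

text \<open>A cleared submarket and those inside it have no supply left, so their gaps are
  nonpositive whatever the demand.\<close>

lemma balanced_clear:
  assumes "balanced M D s t"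
  shows "balanced M D (clear M D t s) (Suc t)"
proof (cases "gap M s (residual D s) t \<le> 0")
  case True
  then show ?thesis
    using assms unfolding balanced_def by (simp add: clear_balanced less_Suc_eq)
next
  case False
  then have "0 < gap M s (residual D s) t" by simp
  then show ?thesis
    unfolding balanced_def by (auto simp: gap_def[of M "clear M D t s"] sub_supply_clear sum_nonneg)
qed

subsection \<open>What one bidder can reach against sincere opponents\<close>

text \<open>The price \<open>p\<close> is hypothetical, separate from that of \<open>s\<close>. For
  a fixed state the value does not depend on \<open>D i\<close>.\<close>

definition slack :: "market \<Rightarrow> profile \<Rightarrow> nat \<Rightarrow> auction_state \<Rightarrow> nat \<Rightarrow> nat \<Rightarrow> int" where
  "slack M D i s p = gap M s ((\<lambda>j. D j p - obtained s j)(i := 0))"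

text \<open>By Hall's deficiency formula, the peak up to \<open>T\<close> counts the items of tiers
  up to \<open>T\<close> left over when the opponents take as many as possible at \<open>p\<close>.
  The second peak discounts those of tiers too low for \<open>i\<close>.\<close>

definition reach :: "market \<Rightarrow> profile \<Rightarrow> nat \<Rightarrow> auction_state \<Rightarrow> nat \<Rightarrow> int" where
  "reach M D i s p = int (obtained s i) + peak (slack M D i s p) (num_tiers M)
     - peak (slack M D i s p) (low M i - 1)"

text \<open>Covers both runs to be compared: bidder \<open>i\<close> only obeys the activity rule,
  and may or may not be sincere.\<close>

locale auction_run =
  fixes M :: market and u :: "nat \<Rightarrow> nat \<Rightarrow> nat" and i :: nat and D :: profile
  assumes inst: "tiered_instance M u" and bidder: "i \<in> bidders M"
    and own: "antimono (D i)" and others: "\<And>j. j \<noteq> i \<Longrightarrow> D j = sincere M u j"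
begin

lemma D_antimono: "p \<le> p' \<Longrightarrow> D j p' \<le> D j p"
  using own others[of j] sincere_antimono antimonoD by metis

lemma low_tiers: "j \<in> bidders M \<Longrightarrow> low M j \<in> tiers M"
  using inst unfolding tiered_instance_def by blast

lemma low_i: "0 < low M i" "low M i \<le> num_tiers M"
  using low_tiers[OF bidder] unfolding tiers_def by auto

lemma i_sub_iff: "i \<in> sub_bidders M t \<longleftrightarrow> low M i \<le> t"
  using bidder unfolding sub_bidders_def by simp

lemma gap_0 [simp]: "gap M s f 0 = 0"
proof -
  have "sub_bidders M 0 = {}"
    using low_tiers unfolding sub_bidders_def tiers_def by force
  then show ?thesis unfolding gap_def sub_supply_def by simp
qed

lemma slack_0 [simp]: "slack M D i s p 0 = 0"
  unfolding slack_def by simp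

lemma peak_slack_nonneg: "0 \<le> peak (slack M D i s p) T"
  using peak_ge[of 0 T "slack M D i s p"] by simp

lemma reach_ge_obtained: "int (obtained s i) \<le> reach M D i s p"
  unfolding reach_def using peak_mono[of "low M i - 1" "num_tiers M" "slack M D i s p"] low_i by simp

lemma slack_price: "slack M D i s (price s) = gap M s ((residual D s)(i := 0))"
  unfolding slack_def residual_def ..

text \<open>Demand only falls as the price rises, so comparisons of submarkets made at the current
  price carry over to later ones.\<close>

lemma slack_diff:
  assumes "t1 \<le> t" "price s \<le> p"
  shows "slack M D i s (price s) t - slack M D i s (price s) t1
    \<le> slack M D i s p t - slack M D i s p t1"
  unfolding slack_def using assms D_antimono by (intro gap_diff_mono) (auto intro: diff_le_mono)

lemma slack_below: "t < low M i \<Longrightarrow> slack M D i s (price s) t = gap M s (residual D s) t"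
  unfolding slack_price by (simp add: gap_upd i_sub_iff)

lemma slack_clinch_self:
  "available M s i k \<Longrightarrow> slack M D i (clinch M i s) p t =
    slack M D i s p t - (if least_item M s i \<le> t then 1 else 0)"
proof -
  assume k: "available M s i k"
  have "(\<lambda>j. D j p - obtained (clinch M i s) j)(i := 0) = (\<lambda>j. D j p - obtained s j)(i := 0)"
    by auto
  then show ?thesis unfolding slack_def by (simp only: gap_clinch[OF k])
qed

lemma slack_clinch_other:
  assumes k: "available M s j k" and "j \<noteq> i"
  shows "slack M D i (clinch M j s) p t =
    slack M D i s p t + (if j \<in> sub_bidders M t \<and> obtained s j < D j p then 1 else 0)
    - (if least_item M s j \<le> t then 1 else 0)"
proof -
  let ?f = "(\<lambda>j. D j p - obtained s j)(i := 0)"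
  have "(\<lambda>l. D l p - obtained (clinch M j s) l)(i := 0) = ?f(j := ?f j - 1)"
    using assms(2) by auto
  then show ?thesis
    unfolding slack_def by (simp only: gap_clinch[OF k] gap_upd) (use assms(2) in auto)
qed

lemma slack_empty_tiers:
  assumes "j \<in> bidders M" "low M j \<le> t" "t < least_item M s j" "t \<le> num_tiers M"
  shows "slack M D i s p t + (if j = i then 0 else int (D j p - obtained s j))
    \<le> slack M D i s p (low M j - 1)"
proof -
  have "\<not> available M s j k" if "k \<le> t" for k
    using assms(3) that by (intro not_available_below) simp
  then show ?thesis
    using assms low_tiers[of j]
      gap_unavailable[of j M t s "(\<lambda>j. D j p - obtained s j)(i := 0)"]
    unfolding slack_def by (simp add: sub_bidders_def split: if_splits)
qed

section \<open>How a clinch changes the reach\<close>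

lemma clinch_cases:
  assumes "first_pair M D s = Some (t0, j)"
  obtains k where "available M s j k" "0 < gap M s ((residual D s)(j := 0)) t0"
    "0 < t0" "t0 \<le> num_tiers M" "j \<in> bidders M" "0 < low M j" "low M j \<le> t0"
    "low M j \<le> least_item M s j" "least_item M s j \<le> num_tiers M"
proof -
  obtain k where k: "available M s j k" "0 < gap M s ((residual D s)(j := 0)) t0"
    using first_pair_SomeD(1)[OF assms] can_clinch_iff by blast
  then show ?thesis
    using that[OF k] first_pair_SomeD(2,3)[OF assms] available_least_item[OF k(1)] low_tiers[of j]
    unfolding available_def sub_bidders_def tiers_def by auto
qed

text \<open>The item gained is offset by the upper peak, which falls by one: every submarket below
  the item has less slack than \<open>t0\<close>, either by balance or because its tiers acceptable
  to \<open>i\<close> are empty. The lower peak does not see the item.\<close>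

lemma reach_clinch_self_le:
  assumes fp: "first_pair M D s = Some (t0, i)" and bal: "balanced M D s (low M i)"
    and p: "price s \<le> p"
  shows "reach M D i (clinch M i s) p \<le> reach M D i s p"
    and "int (obtained s i) < reach M D i s (price s)"
proof -
  obtain k where k: "available M s i k" "0 < gap M s ((residual D s)(i := 0)) t0"
    "t0 \<le> num_tiers M" "low M i \<le> t0" "low M i \<le> least_item M s i"
    "least_item M s i \<le> num_tiers M"
    using fp by (rule clinch_cases)
  let ?k = "least_item M s i"
  have strict: "slack M D i s p t < slack M D i s p t0" if "t < ?k" "price s \<le> p" for t p
  proof -
    have below: "slack M D i s p t < slack M D i s p t0" if "t < low M i" for t
      using slack_diff[of t t0 s p] balancedD[OF bal that] slack_below[OF that] k that
        \<open>price s \<le> p\<close> by (auto simp: slack_price)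
    show ?thesis
    proof (cases "t < low M i")
      case False
      then have "slack M D i s p t \<le> slack M D i s p (low M i - 1)"
        using slack_empty_tiers[OF bidder, of t s p] that k by simp
      then show ?thesis
        using below[of "low M i - 1"] low_i by linarith
    qed (rule below)
  qed
  have top: "peak (slack M D i (clinch M i s) p) (num_tiers M)
      = peak (slack M D i s p) (num_tiers M) - 1"
    by (rule peak_drop_strict[OF slack_clinch_self[OF k(1)] k(3)]) (rule strict[OF _ p])
  have bot: "peak (slack M D i (clinch M i s) p) (low M i - 1) = peak (slack M D i s p) (low M i - 1)"
    using k(5) low_i by (intro peak_cong) (auto simp: slack_clinch_self[OF k(1)])
  show "reach M D i (clinch M i s) p \<le> reach M D i s p"
    unfolding reach_def using top bot by simp
  have "peak (slack M D i s (price s)) (low M i - 1) \<le> 0"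
    unfolding peak_le_iff using bal low_i by (auto simp: slack_below intro!: balancedD)
  then show "int (obtained s i) < reach M D i s (price s)"
    unfolding reach_def using k(2) peak_ge[OF k(3), of "slack M D i s (price s)"]
    by (simp add: slack_price)
qed

lemma reach_clinch_self_ge:
  assumes "available M s i k"
  shows "reach M D i s p \<le> reach M D i (clinch M i s) p"
  unfolding reach_def
  using peak_drop_ge[OF slack_clinch_self[OF assms, where p = p], where T = "num_tiers M"]
    peak_drop_le[OF slack_clinch_self[OF assms, where p = p], where T = "low M i - 1"]
  by simp

text \<open>From the tier of the item on, supply and demand fall together; the empty tiers before it
  are handled by \<open>peak_bump\<close>.\<close>

lemma reach_clinch_other_demanding:
  assumes fp: "first_pair M D s = Some (t0, j)" and "j \<noteq> i" "obtained s j < D j p"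
  shows "reach M D i (clinch M j s) p = reach M D i s p"
proof -
  obtain k where k: "available M s j k" "j \<in> bidders M" "0 < low M j"
    "low M j \<le> least_item M s j" "least_item M s j \<le> num_tiers M"
    using fp by (rule clinch_cases)
  have "peak (slack M D i (clinch M j s) p) T = peak (slack M D i s p) T" for T
  proof (rule peak_bump[OF _ _ k(3)])
    show "slack M D i (clinch M j s) p t = slack M D i s p t
        + (if low M j \<le> t \<and> t < least_item M s j then 1 else 0)" for t
      using slack_clinch_other[OF k(1) assms(2), of p t] assms(3) k
      by (auto simp: sub_bidders_def)
    show "slack M D i s p t + 1 \<le> slack M D i s p (low M j - 1)"
      if "low M j \<le> t" "t < least_item M s j" for t
      using slack_empty_tiers[OF k(2), of t s p] that k assms by simp
  qed
  then show ?thesis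
    unfolding reach_def using assms(2) by simp
qed

lemma slack_clinch_satisfied:
  assumes "available M s j k" "j \<noteq> i" "\<not> obtained s j < D j p"
  shows "slack M D i (clinch M j s) p t = slack M D i s p t - (if least_item M s j \<le> t then 1 else 0)"
  using slack_clinch_other[OF assms(1,2), of p t] assms(3) by simp

lemma reach_clinch_other_le:
  assumes fp: "first_pair M D s = Some (t0, j)" and "j \<noteq> i"
  shows "reach M D i (clinch M j s) p \<le> reach M D i s p"
proof (cases "obtained s j < D j p")
  case True
  then show ?thesis using reach_clinch_other_demanding[OF assms] by simp
next
  case False
  obtain k where k: "available M s j k"
    using fp by (rule clinch_cases)
  show ?thesis
    using peak_drop_diff[OF slack_clinch_satisfied[OF k assms(2) False], of "low M i - 1" "num_tiers M"]
      low_i assms(2) unfolding reach_def by simp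
qed

text \<open>The critical \<open>j\<close> wants no further item at \<open>p\<close>, so an item is
  lost. If \<open>i\<close> is in submarket \<open>t0\<close>, enough remains for its current
  residual demand. Otherwise the lower peak falls by one as well and offsets the loss.\<close>

lemma reach_clinch_other_ge:
  assumes fp: "first_pair M D s = Some (t0, j)" and ji: "j \<noteq> i"
    and bal: "balanced M D s (Suc (num_tiers M))" and p: "price s \<le> p"
  shows "min (reach M D i s p) (int (D i p)) \<le> reach M D i (clinch M j s) p"
proof (cases "obtained s j < D j p")
  case True
  then show ?thesis using reach_clinch_other_demanding[OF assms(1,2)] by simp
next
  case False
  obtain k where k: "available M s j k" "0 < gap M s ((residual D s)(j := 0)) t0"
    "0 < t0" "t0 \<le> num_tiers M" "j \<in> bidders M" "0 < low M j" "low M j \<le> t0"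
    "low M j \<le> least_item M s j" "least_item M s j \<le> num_tiers M"
    using fp by (rule clinch_cases)
  let ?k = "least_item M s j" and ?h = "(residual D s)(j := 0)"
  let ?g = "slack M D i s p" and ?g' = "slack M D i (clinch M j s) p"
  note drop = slack_clinch_satisfied[OF k(1) ji False]
  \<comment> \<open>At price \<open>p\<close> bidder \<open>j\<close> wants no further item, so its current demand may be left out of the
    comparison with the current price.\<close>
  have diff: "gap M s (?h(i := 0)) t0 - gap M s (?h(i := 0)) t \<le> ?g t0 - ?g t" if "t \<le> t0" for t
    unfolding slack_def using that False D_antimono[OF p]
    by (intro gap_diff_mono) (auto simp: residual_def intro: diff_le_mono)
  show ?thesis
  proof (cases "low M i \<le> t0")
    case True
    obtain t1 where t1: "t1 \<le> low M i - 1" "peak ?g' (low M i - 1) = ?g' t1"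
      by (rule peak_attained)
    have t1': "t1 < t0" "\<not> low M i \<le> t1" using t1 True low_i by auto
    \<comment> \<open>Otherwise \<open>(t1, j)\<close> would precede \<open>(t0, j)\<close> in the search.\<close>
    have "gap M s ?h t1 \<le> 0"
    proof (cases "j \<in> sub_bidders M t1")
      case in_t1: True
      then have "t1 \<in> tiers M"
        using k t1' unfolding sub_bidders_def tiers_def by auto
      then show ?thesis
        using first_pair_earlier[OF fp t1'(1) _ in_t1] k(1) can_clinch_iff[of M D s t1 j] by auto
    next
      case False
      then show ?thesis
        using balancedD[OF bal, of t1] t1' k(4) by (simp add: gap_upd)
    qed
    \<comment> \<open>The extra 1 pays for the item taken by \<open>j\<close>.\<close>
    then have "1 + int (residual D s i) \<le> ?g t0 - ?g t1"
      using diff[of t1] k(2) t1' True ji by (simp add: gap_upd[of M s ?h] i_sub_iff)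
    moreover have "?g t0 - 1 \<le> ?g' t0" "?g' t1 \<le> ?g t1"
      using drop by auto
    ultimately have "int (residual D s i) \<le> peak ?g' (num_tiers M) - peak ?g' (low M i - 1)"
      using t1(2) peak_ge[OF k(4), of ?g'] by linarith
    then show ?thesis
      using D_antimono[OF p, of i] ji unfolding reach_def residual_def by simp
  next
    case i_above: False
    have below: "?g t < ?g t0" if "t < low M j" for t
      using diff[of t] k(2,4,7) that i_above balancedD[OF bal, of t]
      by (simp add: gap_upd[of M s ?h] i_sub_iff) (simp add: gap_upd sub_bidders_def)
    have "?g t < ?g t0" if "t < ?k" for t
    proof (cases "t < low M j")
      case False
      then have "?g t \<le> ?g (low M j - 1)"
        using slack_empty_tiers[OF k(5), of t s p] that k(9) ji by simp
      then show ?thesis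
        using below[of "low M j - 1"] k(6) by linarith
    qed (rule below)
    then have "peak ?g' (low M i - 1) = peak ?g (low M i - 1) - 1"
      using i_above by (intro peak_drop_strict[OF drop, of t0]) auto
    moreover have "peak ?g (num_tiers M) - 1 \<le> peak ?g' (num_tiers M)"
      by (rule peak_drop_ge[OF drop])
    ultimately show ?thesis
      using ji unfolding reach_def by simp
  qed
qed

section \<open>How the initial clearing changes the reach\<close>

lemma slack_clear:
  assumes under: "0 < gap M s (residual D s) t" and p: "price s \<le> p"
  shows "slack M D i (clear M D t s) p t' =
    (if t' \<le> t then 0 else slack M D i s p t' - slack M D i s p t)"
proof -
  let ?f = "\<lambda>s. (\<lambda>j. D j p - obtained s j)(i := 0)"
  \<comment> \<open>Bidders served in full now want nothing at later prices either.\<close>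
  have zero: "?f (clear M D t s) j = 0" if "j \<in> sub_bidders M t" for j
    using that D_antimono[OF p, of j] by (auto simp: clear_undersubscribed[OF under] residual_def)
  show ?thesis
  proof (cases "t' \<le> t")
    case True
    then show ?thesis
      using zero sub_bidders_mono[OF True, of M]
      unfolding slack_def gap_def by (simp add: sub_supply_clear[OF under] subset_iff)
  next
    case False
    then have sub: "sub_bidders M t \<subseteq> sub_bidders M t'"
      by (intro sub_bidders_mono) simp
    have "(\<Sum>j\<in>sub_bidders M t'. int (?f (clear M D t s) j))
        = (\<Sum>j\<in>sub_bidders M t' - sub_bidders M t. int (?f (clear M D t s) j))"
      using zero sub by (intro sum.mono_neutral_right) auto
    also have "\<dots> = (\<Sum>j\<in>sub_bidders M t' - sub_bidders M t. int (?f s j))"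
      by (intro sum.cong) (auto simp: clear_undersubscribed[OF under])
    also have "\<dots> = (\<Sum>j\<in>sub_bidders M t'. int (?f s j)) - (\<Sum>j\<in>sub_bidders M t. int (?f s j))"
      by (rule sum_diff[OF _ sub]) simp
    finally show ?thesis
      using False unfolding slack_def gap_def by (simp add: sub_supply_clear[OF under])
  qed
qed

text \<open>Both peaks shift by the slack of \<open>t\<close>, which cancels.\<close>

lemma reach_clear_below:
  assumes bal: "balanced M D s t" and p: "price s \<le> p" and t: "t < low M i"
  shows "reach M D i (clear M D t s) p = reach M D i s p"
proof (cases "gap M s (residual D s) t \<le> 0")
  case False
  then have under: "0 < gap M s (residual D s) t" by simp
  have "slack M D i s p t1 \<le> slack M D i s p t" if "t1 < t" for t1
    using slack_diff[of t1 t s p] balancedD[OF bal that] that t under p by (simp add: slack_below)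
  then have "peak (slack M D i (clear M D t s) p) T = peak (slack M D i s p) T - slack M D i s p t"
    if "t \<le> T" for T
    by (intro peak_clear slack_clear under p that)
  then show ?thesis
    using t low_i unfolding reach_def by (simp add: clear_undersubscribed[OF under] i_sub_iff)
qed (simp add: clear_balanced)

text \<open>If \<open>i\<close> is served, the upper peak falls by at least the slack of
  \<open>t\<close>; this covers the items given to \<open>i\<close> plus the whole lower
  peak.\<close>

lemma reach_clear_le:
  assumes bal: "balanced M D s t" and p: "price s \<le> p" and t: "t \<le> num_tiers M"
  shows "reach M D i (clear M D t s) p \<le> reach M D i s p"
proof (cases "gap M s (residual D s) t \<le> 0 \<or> t < low M i")
  case True
  then show ?thesis
    using reach_clear_below[OF bal p] by (auto simp: clear_balanced)
next
  case False
  then have under: "0 < gap M s (residual D s) t" and lt: "low M i \<le> t" by auto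
  let ?g = "slack M D i s p" and ?g' = "slack M D i (clear M D t s) p"
  have "?g t1 + int (residual D s i) \<le> ?g t" if "t1 \<le> low M i - 1" for t1
  proof -
    have "t1 < low M i" "t1 < t" using that lt low_i by auto
    then show ?thesis
      using slack_diff[of t1 t s p] balancedD[OF bal, of t1] slack_below[of t1 s] under p lt
      by (simp add: slack_price[of s] gap_upd i_sub_iff)
  qed
  then have "peak ?g (low M i - 1) + int (residual D s i) \<le> ?g t"
    using peak_attained[of "low M i - 1" ?g] by metis
  moreover have "peak ?g' (num_tiers M) \<le> peak ?g (num_tiers M) - ?g t"
    by (intro peak_clear_le slack_clear under p t)
  ultimately show ?thesis
    using peak_slack_nonneg[of "clear M D t s" p "low M i - 1"] lt
    unfolding reach_def by (simp add: clear_undersubscribed[OF under] i_sub_iff)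
qed

lemma reach_clear_ge:
  assumes bal: "balanced M D s t" and p: "price s \<le> p"
  shows "min (reach M D i s p) (int (D i p)) \<le> reach M D i (clear M D t s) p"
proof (cases "gap M s (residual D s) t \<le> 0 \<or> t < low M i")
  case True
  then show ?thesis
    using reach_clear_below[OF bal p] by (auto simp: clear_balanced)
next
  case False
  then have "D i p \<le> obtained (clear M D t s) i"
    using D_antimono[OF p, of i] by (simp add: clear_undersubscribed residual_def i_sub_iff)
  then show ?thesis
    using reach_ge_obtained[of "clear M D t s" p] by simp
qed

section \<open>Price increases and termination\<close>

lemma slack_nonpos_without_pair:
  assumes fp: "first_pair M D s = None" and bal: "balanced M D s (low M i)" and t: "t \<le> num_tiers M"
  shows "slack M D i s (price s) t \<le> 0"
proof -
  have below: "slack M D i s (price s) t \<le> 0" if "t < low M i" for t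
    using slack_below[OF that] balancedD[OF bal that] by simp
  show ?thesis
  proof (cases "t < low M i")
    case False
    then have it: "i \<in> sub_bidders M t" "t \<in> tiers M"
      using t low_i by (auto simp: i_sub_iff tiers_def)
    \<comment> \<open>If the clinching inequality holds, the tiers of \<open>i\<close> must be
      empty, and the last submarket without \<open>i\<close> bounds the slack.\<close>
    then consider "slack M D i s (price s) t \<le> 0" | "\<And>k. \<not> available M s i k"
      using first_pair_NoneD[OF fp it(2,1)] unfolding can_clinch_iff slack_price by force
    then show ?thesis
    proof cases
      case 2
      then have "slack M D i s (price s) t \<le> slack M D i s (price s) (low M i - 1)"
        using gap_unavailable[OF it(1) low_tiers[OF bidder] t, of s "(residual D s)(i := 0)"]
        unfolding slack_price by simp
      then show ?thesis
        using below[of "low M i - 1"] low_i by simp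
    qed
  qed (rule below)
qed

lemma reach_le_obtained:
  assumes "\<And>t. t \<le> num_tiers M \<Longrightarrow> slack M D i s p t \<le> 0"
  shows "reach M D i s p \<le> int (obtained s i)"
proof -
  have "peak (slack M D i s p) (num_tiers M) \<le> 0"
    using assms unfolding peak_le_iff by blast
  then show ?thesis
    using peak_slack_nonneg[of s p "low M i - 1"] unfolding reach_def by simp
qed

lemma low_i_le: "low M i \<le> Suc (num_tiers M)"
  using low_i by simp

lemma balanced_initial_clearing: "balanced M D (initial_clearing M D) (Suc (num_tiers M))"
  and reach_initial_clearing_le: "reach M D i (initial_clearing M D) p \<le> reach M D i (initial_state M) p"
  and reach_initial_clearing_ge:
    "min (reach M D i (initial_state M) p) (int (D i p)) \<le> reach M D i (initial_clearing M D) p"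
  and initial_clearing_simps: "price (initial_clearing M D) = 0" "paid (initial_clearing M D) = (\<lambda>_. 0)"
proof -
  define c where "c t = fold (clear M D) [1..<Suc t] (initial_state M)" for t
  have c_Suc: "c (Suc t) = clear M D (Suc t) (c t)" for t
    unfolding c_def by simp
  have price: "price (c t) = 0" and paid: "paid (c t) = (\<lambda>_. 0)" for t
    by (induction t) (simp_all add: c_Suc, simp_all add: c_def initial_state_def)
  have bal: "balanced M D (c t) (Suc t)" for t
  proof (induction t)
    case 0
    show ?case unfolding balanced_def by simp
  qed (simp add: c_Suc balanced_clear)
  have "reach M D i (c t) p \<le> reach M D i (initial_state M) p \<and>
      min (reach M D i (initial_state M) p) (int (D i p)) \<le> reach M D i (c t) p"
    if "t \<le> num_tiers M" for t
    using that
  proof (induction t)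
    case 0
    then show ?case by (simp add: c_def)
  next
    case (Suc t)
    then show ?case
      using reach_clear_le[OF bal, of t p] reach_clear_ge[OF bal, of t p]
      unfolding c_Suc by (simp add: price) linarith
  qed
  then show "reach M D i (initial_clearing M D) p \<le> reach M D i (initial_state M) p"
    "min (reach M D i (initial_state M) p) (int (D i p)) \<le> reach M D i (initial_clearing M D) p"
    unfolding initial_clearing_def c_def by auto
  show "balanced M D (initial_clearing M D) (Suc (num_tiers M))"
    "price (initial_clearing M D) = 0" "paid (initial_clearing M D) = (\<lambda>_. 0)"
    using bal price paid unfolding initial_clearing_def c_def by auto
qed

lemma balanced_step:
  assumes "balanced M D s T" "T \<le> Suc (num_tiers M)" "T \<le> low M i \<or> D i = sincere M u i"
  shows "balanced M D (step M D s) T"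
proof (cases "first_pair M D s")
  case None
  have "D j = sincere M u j" if "low M j < T" for j
    using that assms(3) others[of j] by (cases "j = i") auto
  then show ?thesis
    using balanced_price[OF inst assms(1,2) _ None] None unfolding step_def by simp
next
  case (Some tj)
  then obtain t0 j where fp: "first_pair M D s = Some (t0, j)" by (cases tj) auto
  then show ?thesis
    using balanced_clinch[OF assms(1,2) fp] first_pair_SomeD(3)[OF fp] low_tiers
    unfolding step_def sub_bidders_def by simp
qed

lemma others_eventually_zero:
  obtains P where "\<And>j p. j \<in> bidders M \<Longrightarrow> j \<noteq> i \<Longrightarrow> P \<le> p \<Longrightarrow> D j p = 0"
proof
  let ?P = "\<Sum>j\<in>bidders M. \<Sum>l\<in>{1..total_qty M}. u j l"
  fix j p assume j: "j \<in> bidders M" "j \<noteq> i" and p: "?P \<le> p"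
  have "u j l \<le> p" if "l \<in> {1..total_qty M}" for l
  proof -
    have "u j l \<le> (\<Sum>l\<in>{1..total_qty M}. u j l)"
      using that by (intro member_le_sum) auto
    also have "\<dots> \<le> ?P"
      using j by (intro member_le_sum[of j _ "\<lambda>j. \<Sum>l\<in>{1..total_qty M}. u j l"])
        (auto simp: bidders_def)
    finally show ?thesis using p by simp
  qed
  then have "{l \<in> {1..total_qty M}. p < u j l} = {}" by force
  then show "D j p = 0"
    unfolding others[OF j(2)] sincere_def by simp
qed

lemma auction_induct:
  assumes init: "P (initial_clearing M D)"
    and step: "\<And>s. balanced M D s (low M i) \<Longrightarrow> P s \<Longrightarrow> P (step M D s)"
  shows "P (auction M D)" "finished M D (auction M D)"
proof -
  obtain B where B: "\<And>j p. j \<in> bidders M \<Longrightarrow> j \<noteq> i \<Longrightarrow> B \<le> p \<Longrightarrow> D j p = 0"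
    by (rule others_eventually_zero) blast
  \<comment> \<open>A clinch lowers the supply. The price rises only below \<open>B\<close>: from
    there on opponents demand nothing, so any item left would make the slack positive.\<close>
  let ?m = "\<lambda>s. sub_supply s (num_tiers M) + (B - price s)"
  let ?I = "\<lambda>s. balanced M D s (low M i) \<and> P s"
  have decrease: "?m (step M D s) < ?m s"
    if bal: "balanced M D s (low M i)" and nf: "\<not> finished M D s" for s
  proof (cases "first_pair M D s")
    case None
    then obtain k where k: "k \<in> tiers M" "0 < remaining s k"
      using nf unfolding finished_def by auto
    then have "remaining s k \<le> sub_supply s (num_tiers M)"
      unfolding sub_supply_def tiers_def by (intro member_le_sum) auto
    moreover have "slack M D i s (price s) (num_tiers M) = int (sub_supply s (num_tiers M))"
      if "B \<le> price s"
      unfolding slack_def gap_def using B[OF _ _ that] by (auto simp: sub_bidders_def intro!: sum.neutral)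
    ultimately have "price s < B"
      using slack_nonpos_without_pair[OF None bal, of "num_tiers M"] k by (cases "B \<le> price s") auto
    then show ?thesis
      using None unfolding step_def by (simp add: sub_supply_def)
  next
    case (Some tj)
    then obtain t0 j where fp: "first_pair M D s = Some (t0, j)" by (cases tj) auto
    obtain k where "available M s j k" "least_item M s j \<le> num_tiers M"
      using fp by (rule clinch_cases)
    then have "sub_supply (clinch M j s) (num_tiers M) < sub_supply s (num_tiers M)"
      using sub_supply_clinch[of M s j k "num_tiers M"] by simp
    then show ?thesis
      using fp unfolding step_def by simp
  qed
  have "?I (auction M D) \<and> finished M D (auction M D)"
    unfolding auction_def
  proof (rule while_rule[where P = ?I and r = "Wellfounded.measure ?m"])
    show "?I (initial_clearing M D)"
      using init balanced_mono[OF balanced_initial_clearing low_i_le] by simp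
    show "?I (step M D s)" if "?I s" for s
      using that step balanced_step[OF _ low_i_le] by simp
    show "(step M D s, s) \<in> Wellfounded.measure ?m" if "?I s" "\<not> finished M D s" for s
      using decrease that by simp
  qed auto
  then show "P (auction M D)" "finished M D (auction M D)" by auto
qed

subsection \<open>Personalized prices\<close>

definition threshold :: "nat \<Rightarrow> int" where
  "threshold p = reach M D i (initial_state M) p"

text \<open>\<open>LEAST\<close> is informative only if some price has threshold at least
  \<open>k\<close>, so later facts carry such a price along.\<close>

definition cost :: "nat \<Rightarrow> nat" where
  "cost k = (LEAST p. int k \<le> threshold p)"

lemma cost_le: "int k \<le> threshold p \<Longrightarrow> cost k \<le> p"
  unfolding cost_def by (rule Least_le)

lemma threshold_cost: "int k \<le> threshold p \<Longrightarrow> int k \<le> threshold (cost k)"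
  unfolding cost_def by (rule LeastI)

text \<open>Keeps item numbers in the range where \<open>sincere_ge_iff\<close> applies.\<close>

lemma threshold_le: "threshold p \<le> int (total_qty M)"
proof -
  have "slack M D i (initial_state M) p t \<le> int (total_qty M)" if "t \<le> num_tiers M" for t
  proof -
    have "slack M D i (initial_state M) p t \<le> int (sub_supply (initial_state M) t)"
      unfolding slack_def gap_def by (simp add: sum_nonneg)
    also have "\<dots> \<le> int (sub_supply (initial_state M) (num_tiers M))"
      using sub_supply_mono[OF that] by simp
    finally show ?thesis
      unfolding sub_supply_def initial_state_def total_qty_def tiers_def by simp
  qed
  then have "peak (slack M D i (initial_state M) p) (num_tiers M) \<le> int (total_qty M)"
    unfolding peak_le_iff by blast
  then show ?thesis
    using peak_slack_nonneg[of "initial_state M" p "low M i - 1"]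
    unfolding threshold_def reach_def by (simp add: initial_state_def)
qed

lemma payment_lower_bound:
  defines "x \<equiv> obtained (auction M D) i"
  shows "(\<Sum>k=1..x. cost k) \<le> paid (auction M D) i" and "\<exists>p. int x \<le> threshold p"
proof -
  let ?P = "\<lambda>s. (\<forall>p\<ge>price s. reach M D i s p \<le> threshold p) \<and>
    (\<Sum>k=1..obtained s i. cost k) \<le> paid s i"
  have "?P (auction M D)"
  proof (rule auction_induct(1))
    \<comment> \<open>Items received for free in the clearing are already within the threshold at
      price 0.\<close>
    have "cost k = 0" if "k \<le> obtained (initial_clearing M D) i" for k
      using that reach_ge_obtained[of "initial_clearing M D" 0] reach_initial_clearing_le[of 0]
        cost_le[of k 0] unfolding threshold_def by simp
    then show "?P (initial_clearing M D)"
      using reach_initial_clearing_le unfolding threshold_def by (simp add: initial_clearing_simps)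
  next
    fix s assume bal: "balanced M D s (low M i)" and P: "?P s"
    show "?P (step M D s)"
    proof (cases "first_pair M D s")
      case None
      have "reach M D i (s\<lparr>price := q\<rparr>) p = reach M D i s p" for p q
        unfolding reach_def slack_def gap_def sub_supply_def by simp
      then show ?thesis
        using P None unfolding step_def by simp
    next
      case (Some tj)
      then obtain t0 j where fp: "first_pair M D s = Some (t0, j)" by (cases tj) auto
      then have step: "step M D s = clinch M j s"
        unfolding step_def by simp
      show ?thesis
      proof (cases "j = i")
        case True
        note le = reach_clinch_self_le[OF fp[unfolded True] bal]
        have "int (obtained s i) < threshold (price s)"
          using le(2) P by (meson order.strict_trans2 order_refl)
        then have "cost (Suc (obtained s i)) \<le> price s"
          by (intro cost_le) simp
        moreover have "reach M D i (clinch M i s) p \<le> threshold p" if "price s \<le> p" for p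
          using le(1)[OF that] P that by (meson order_trans)
        ultimately show ?thesis
          using P unfolding step True by simp
      next
        case False
        have "reach M D i (clinch M j s) p \<le> threshold p" if "price s \<le> p" for p
          using reach_clinch_other_le[OF fp False, of p] P that by (meson order_trans)
        then show ?thesis
          using P False unfolding step by simp
      qed
    qed
  qed
  then show "(\<Sum>k=1..x. cost k) \<le> paid (auction M D) i" "\<exists>p. int x \<le> threshold p"
    using reach_ge_obtained[of "auction M D"] unfolding x_def by (auto intro: order_trans)
qed

lemma sincere_payment:
  assumes D_i: "D i = sincere M u i"
  defines "x \<equiv> obtained (auction M D) i"
  shows "paid (auction M D) i \<le> (\<Sum>k=1..x. cost k)"
    and "k \<in> {1..x} \<Longrightarrow> cost k \<le> u i k"
    and "x < k \<Longrightarrow> int k \<le> threshold p \<Longrightarrow> u i k \<le> cost k"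
proof -
  let ?N = "num_tiers M"
  \<comment> \<open>The third conjunct keeps demanded items within reach at prices not yet left; the
    fourth says that at prices already left they have been obtained.\<close>
  let ?P = "\<lambda>s. balanced M D s (Suc ?N)
    \<and> (\<forall>p\<ge>price s. reach M D i s p \<le> threshold p)
    \<and> (\<forall>p\<ge>price s. min (threshold p) (int (D i p)) \<le> reach M D i s p)
    \<and> (\<forall>p<price s. min (threshold p) (int (D i p)) \<le> int (obtained s i))
    \<and> paid s i \<le> (\<Sum>k=1..obtained s i. cost k) \<and> (\<forall>k\<in>{1..obtained s i}. cost k \<le> u i k)"
  have P: "?P (auction M D)"
  proof (rule auction_induct(1))
    have "cost k = 0" if "k \<le> obtained (initial_clearing M D) i" for k
      using that reach_ge_obtained[of "initial_clearing M D" 0] reach_initial_clearing_le[of 0]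
        cost_le[of k 0] unfolding threshold_def by simp
    then show "?P (initial_clearing M D)"
      using reach_initial_clearing_le reach_initial_clearing_ge balanced_initial_clearing
      unfolding threshold_def by (simp add: initial_clearing_simps)
  next
    fix s assume bal: "balanced M D s (low M i)" and P: "?P s"
    have bal': "balanced M D (step M D s) (Suc ?N)"
      using balanced_step P D_i by blast
    show "?P (step M D s)"
    proof (cases "first_pair M D s")
      case None
      have same: "reach M D i (s\<lparr>price := q\<rparr>) p = reach M D i s p" for p q
        unfolding reach_def slack_def gap_def sub_supply_def by simp
      \<comment> \<open>Before the price rises everything within reach has been taken, which moves
        this price from the third conjunct to the fourth.\<close>
      have "reach M D i s (price s) \<le> int (obtained s i)"
        by (intro reach_le_obtained slack_nonpos_without_pair None bal)
      moreover have "min (threshold (price s)) (int (D i (price s))) \<le> reach M D i s (price s)"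
        using P by blast
      ultimately have "min (threshold (price s)) (int (D i (price s))) \<le> int (obtained s i)"
        by (rule order_trans[rotated])
      then show ?thesis
        using P None bal' same unfolding step_def by (auto simp: less_Suc_eq)
    next
      case (Some tj)
      then obtain t0 j where fp: "first_pair M D s = Some (t0, j)" by (cases tj) auto
      then have step: "step M D s = clinch M j s"
        unfolding step_def by simp
      show ?thesis
      proof (cases "j = i")
        case True
        note fp = fp[unfolded True]
        let ?k = "Suc (obtained s i)"
        obtain k where k: "available M s i k" "0 < gap M s ((residual D s)(i := 0)) t0"
          "t0 \<le> ?N"
          using fp by (rule clinch_cases)
        \<comment> \<open>Submarket \<open>t0\<close> is undersubscribed only without the demand of
          \<open>i\<close>, so a sincere \<open>i\<close> still wants the item it clinches.\<close>
        have "gap M s (residual D s) t0 \<le> 0"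
          using P k(3) by (auto intro: balancedD)
        then have "?k \<le> D i (price s)"
          using k(2) by (auto simp: gap_upd residual_def split: if_splits)
        then have demand: "?k \<le> D i p" if "p \<le> price s" for p
          using D_antimono[OF that, of i] by simp
        have "int (obtained s i) < threshold (price s)"
          using reach_clinch_self_le(2)[OF fp bal] P by (meson order.strict_trans2 order_refl)
        then have reached: "int ?k \<le> threshold (price s)" by simp
        have "?k \<in> {1..total_qty M}"
          using reached threshold_le[of "price s"] by simp
        then have worth: "price s < u i ?k"
          using sincere_ge_iff[OF inst bidder] demand[of "price s"] D_i by simp
        \<comment> \<open>Had the price already left \<open>cost ?k\<close>, the item would have
          been obtained then.\<close>
        have "price s \<le> cost ?k"
        proof (rule ccontr)
          assume "\<not> price s \<le> cost ?k"
          then have "min (threshold (cost ?k)) (int (D i (cost ?k))) \<le> int (obtained s i)"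
            using P by simp
          then show False
            using threshold_cost[OF reached] demand[of "cost ?k"] \<open>\<not> price s \<le> cost ?k\<close> by simp
        qed
        moreover have "cost ?k \<le> u i ?k"
          using cost_le[OF reached] worth by simp
        moreover have "reach M D i (clinch M i s) p \<le> threshold p \<and>
            min (threshold p) (int (D i p)) \<le> reach M D i (clinch M i s) p" if "price s \<le> p" for p
          using P that reach_clinch_self_le(1)[OF fp bal that] reach_clinch_self_ge[OF k(1), of p]
          by (meson order_trans)
        moreover have "min (threshold p) (int (D i p)) \<le> int ?k" if "p < price s" for p
        proof -
          have "min (threshold p) (int (D i p)) \<le> int (obtained s i)" using P that by blast
          then show ?thesis by simp
        qed
        ultimately show ?thesis
          using P bal' unfolding step True by (simp add: atLeastAtMostSuc_conv)
      next
        case False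
        have "reach M D i (clinch M j s) p \<le> threshold p \<and>
            min (threshold p) (int (D i p)) \<le> reach M D i (clinch M j s) p" if "price s \<le> p" for p
        proof -
          have "reach M D i s p \<le> threshold p" "min (threshold p) (int (D i p)) \<le> reach M D i s p"
            "balanced M D s (Suc ?N)"
            using P that by blast+
          then show ?thesis
            using reach_clinch_other_le[OF fp False, of p] reach_clinch_other_ge[OF fp False _ that]
            by simp
        qed
        then show ?thesis
          using P bal' False unfolding step by simp
      qed
    qed
  qed
  then show "paid (auction M D) i \<le> (\<Sum>k=1..x. cost k)" "k \<in> {1..x} \<Longrightarrow> cost k \<le> u i k"
    unfolding x_def by blast+
  show "u i k \<le> cost k" if k: "x < k" "int k \<le> threshold p"
  proof -
    have empty: "\<forall>k\<in>tiers M. remaining (auction M D) k = 0"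
      using auction_induct(2)[of "\<lambda>_. True"] unfolding finished_def by simp
    have "reach M D i (auction M D) p \<le> int x" for p
      unfolding x_def
    proof (rule reach_le_obtained)
      fix t assume "t \<le> ?N"
      then have "sub_supply (auction M D) t = 0"
        using empty unfolding sub_supply_def tiers_def by auto
      then show "slack M D i (auction M D) p t \<le> 0"
        unfolding slack_def gap_def by (simp add: sum_nonneg)
    qed
    \<comment> \<open>The third or the fourth conjunct applies, depending on whether the final price
      has passed \<open>cost k\<close>.\<close>
    then have "min (threshold (cost k)) (int (D i (cost k))) \<le> int x"
      using P unfolding x_def by (meson not_le order_trans)
    then have "\<not> k \<le> D i (cost k)"
      using threshold_cost[OF k(2)] k(1) by simp
    moreover have "k \<in> {1..total_qty M}"
      using k threshold_le[of p] by simp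
    ultimately show ?thesis
      using sincere_ge_iff[OF inst bidder, of k "cost k"] D_i by simp
  qed
qed

end

section \<open>Comparison of the deviating and the sincere run\<close>

theorem theorem14:
  fixes M :: market and u :: "nat \<Rightarrow> nat \<Rightarrow> nat" and i :: nat and d :: "nat \<Rightarrow> nat"
  assumes "tiered_instance M u"
    and "i \<in> bidders M"
    and "antimono d"
  shows "utility M u ((sincere M u)(i := d)) i \<le> utility M u (sincere M u) i"
proof -
  let ?D = "(sincere M u)(i := d)"
  interpret dev: auction_run M u i ?D
    using assms by unfold_locales auto
  interpret sinc: auction_run M u i "sincere M u"
    using assms sincere_antimono by unfold_locales auto
  have "slack M ?D i s p = slack M (sincere M u) i s p" for s p
    unfolding slack_def by (rule arg_cong[where f = "gap M s"]) auto
  then have threshold: "dev.threshold = sinc.threshold"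
    unfolding dev.threshold_def sinc.threshold_def reach_def by simp
  then have cost: "dev.cost = sinc.cost"
    unfolding dev.cost_def sinc.cost_def by simp
  define x where "x = obtained (auction M ?D) i"
  define y where "y = obtained (auction M (sincere M u)) i"
  define gain where "gain k = int (u i k) - int (sinc.cost k)" for k
  obtain p where p: "int x \<le> sinc.threshold p"
    using dev.payment_lower_bound(2) unfolding x_def threshold by blast
  \<comment> \<open>Both runs face the same costs; gains are nonnegative up to \<open>y\<close> and
    nonpositive from there to \<open>x\<close>, so stopping at \<open>y\<close> is at least as
    good.\<close>
  have won: "0 \<le> gain k" if "k \<in> {1..y}" for k
    using sinc.sincere_payment(2)[OF refl] that unfolding y_def gain_def by simp
  have lost: "gain k \<le> 0" if "y < k" "k \<le> x" for k
    using sinc.sincere_payment(3)[OF refl, of k p] that p unfolding y_def gain_def by simp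
  have "utility M u ?D i \<le> (\<Sum>k=1..x. gain k)"
    using dev.payment_lower_bound(1) unfolding utility_def gain_def x_def cost
    by (simp add: sum_subtractf flip: of_nat_sum)
  also have "\<dots> \<le> (\<Sum>k=1..y. gain k)"
  proof (cases "x \<le> y")
    case True
    then show ?thesis using won by (intro sum_mono2) auto
  next
    case False
    then have "{1..x} = {1..y} \<union> {Suc y..x}" by auto
    then have "(\<Sum>k=1..x. gain k) = (\<Sum>k=1..y. gain k) + (\<Sum>k=Suc y..x. gain k)"
      by (simp add: sum.union_disjoint)
    moreover have "(\<Sum>k=Suc y..x. gain k) \<le> 0"
      using lost by (intro sum_nonpos) auto
    ultimately show ?thesis by simp
  qed
  also have "\<dots> \<le> utility M u (sincere M u) i"
    using sinc.sincere_payment(1)[OF refl] unfolding utility_def gain_def y_def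
    by (simp add: sum_subtractf flip: of_nat_sum)
  finally show ?thesis .
qed

end
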